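(* Let $n\ge0$ and $\mu\in\mathrm{Dyck}(2n)$. Then \[ \sum_{\lambda\in\mathrm{Dyck}(2n)} \sum_{T\in\mathcal{D}(\lambda/\mu)} q^{|T|} = \prod_{c\in \mathcal{C}(\mu)} [\mathrm{ht}(c)]_q. \]
   Context: A Dyck path of length $2n$ is a lattice path from $(0,0)$ to $(n,n)$ with up steps $(0,1)$ and down steps $(1,0)$ that never goes below the line $y=x$; $\mathrm{Dyck}(2n)$ denotes the set of them. Cells are unit lattice squares. For $\lambda,\mu\in\mathrm{Dyck}(2n)$ with $\mu$ weakly above $\lambda$, $\lambda/\mu$ is the set of cells in the region between $\lambda$ and $\mu$. A ribbon is an edge-connected skew shape containing no $2\times 2$ block of cells. A Dyck tile is a ribbon such that the path joining the centers of its consecutive cells (by unit up/right moves) is a (translated) Dyck path. A (cover-inclusive) Dyck tiling of $\lambda/\mu$ is a partition of the cells of $\lambda/\mu$ into Dyck tiles such that for any two tiles $T_1,T_2$, if $T_1$ contains the translate by $(1,-1)$ of a cell of $T_2$, then $T_2+(1,-1)\subseteq T_1$. $\mathcal{D}(\lambda/\mu)$ is the set of Dyck tilings of $\lambda/\mu$ (empty if $\mu$ is not weakly above $\lambda$; $\mathcal D(\mu/\mu)$ consists of the empty tiling). $|T|$ is the number of tiles of $T$. The up and down steps of a Dyck path are matched like parentheses; a matched pair is a chord, $\mathcal C(\mu)$ is the set of chords of $\mu$. If the up step of chord $c$ starts at $(x_1,y_1)$, its height is $\mathrm{ht}(c)=y_1-x_1+1$ (i.e. $c$ lies between the lines $y=x+h-1$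 and $y=x+h$ with $h=\mathrm{ht}(c)$). $[h]_q=1+q+\dots+q^{h-1}$. *)

theory Defs
  imports Main
begin

text \<open>Lattice paths are lists of steps: True = up step (0,1), False = down step (1,0).\<close>

definition ups :: "bool list \<Rightarrow> nat" where
  "ups w = length (filter (\<lambda>s. s) w)"

definition downs :: "bool list \<Rightarrow> nat" where
  "downs w = length (filter (\<lambda>s. \<not> s) w)"

definition is_dyck :: "bool list \<Rightarrow> bool" where
  "is_dyck w \<longleftrightarrow> ups w = downs w \<and> (\<forall>k \<le> length w. downs (take k w) \<le> ups (take k w))"

definition dyck_paths :: "nat \<Rightarrow> bool list set" where
  "dyck_paths n = {w. length w = 2 * n \<and> is_dyck w}"

text \<open>Cells are unit squares identified by their lower-left corner.
  col_height P i is the y-coordinate of the down step of P from x = i to x = i+1,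
  i.e. the number of up steps preceding the (i+1)-th down step.\<close>
definition col_height :: "bool list \<Rightarrow> nat \<Rightarrow> nat" where
  "col_height P i = card {k. k < length P \<and> P ! k \<and> downs (take k P) \<le> i}"

definition weakly_above :: "nat \<Rightarrow> bool list \<Rightarrow> bool list \<Rightarrow> bool" where
  "weakly_above n mu lam \<longleftrightarrow> (\<forall>i < n. col_height lam i \<le> col_height mu i)"

definition skew_cells :: "nat \<Rightarrow> bool list \<Rightarrow> bool list \<Rightarrow> (int \<times> int) set" where
  "skew_cells n lam mu =
     {(int i, int j) | i j. i < n \<and> col_height lam i \<le> j \<and> j < col_height mu i}"

text \<open>Dyck tile: a ribbon whose cells, joined centre to centre by unit up/right moves,
  trace a translated Dyck path. (Such a monotone chain of cells is automatically an
  edge-connected skew shape without 2x2 block, i.e. a ribbon.)\<close>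
definition dyck_tile :: "(int \<times> int) set \<Rightarrow> bool" where
  "dyck_tile T \<longleftrightarrow> (\<exists>a b w. is_dyck w \<and>
      T = {(a + int (downs (take k w)), b + int (ups (take k w))) | k. k \<le> length w})"

definition shift :: "(int \<times> int) set \<Rightarrow> (int \<times> int) set" where
  "shift T = (\<lambda>(x, y). (x + 1, y - 1)) ` T"

definition is_dyck_tiling :: "nat \<Rightarrow> bool list \<Rightarrow> bool list \<Rightarrow> (int \<times> int) set set \<Rightarrow> bool" where
  "is_dyck_tiling n lam mu TT \<longleftrightarrow>
     weakly_above n mu lam \<and>
     (\<forall>T \<in> TT. dyck_tile T) \<and>
     pairwise disjnt TT \<and>
     \<Union>TT = skew_cells n lam mu \<and>
     (\<forall>T1 \<in> TT. \<forall>T2 \<in> TT. T1 \<noteq> T2 \<longrightarrow> shift T2 \<inter> T1 \<noteq> {} \<longrightarrow> shift T2 \<subseteq> T1)"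

definition dyck_tilings :: "nat \<Rightarrow> bool list \<Rightarrow> bool list \<Rightarrow> (int \<times> int) set set set" where
  "dyck_tilings n lam mu = {TT. is_dyck_tiling n lam mu TT}"

definition chords :: "bool list \<Rightarrow> (nat \<times> nat) set" where
  "chords w = {(i, j). i < j \<and> j < length w \<and> w ! i \<and> \<not> w ! j \<and>
       int (ups (take (Suc j) w)) - int (downs (take (Suc j) w))
         = int (ups (take i w)) - int (downs (take i w)) \<and>
       (\<forall>k. i < k \<and> k \<le> j \<longrightarrow>
          int (ups (take k w)) - int (downs (take k w))
            > int (ups (take i w)) - int (downs (take i w)))}"

text \<open>Height of chord: up step starts at (x1,y1) = (downs, ups) of the prefix; ht = y1 - x1 + 1.\<close>
definition ht :: "bool list \<Rightarrow> nat \<times> nat \<Rightarrow> int" where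
  "ht w c = int (ups (take (fst c) w)) - int (downs (take (fst c) w)) + 1"

definition qint :: "nat \<Rightarrow> 'a::comm_ring_1 \<Rightarrow> 'a" where
  "qint h q = (\<Sum>i<h. q ^ i)"

end

theory Submission
  imports Defs
begin

text \<open>The generating function \<open>F\<close> of tilings below a path satisfies a two-term recursion at every
  peak \<open>UD\<close> of \<open>mu = a UD b\<close>. If the cell under the peak is a tile by itself, removing it
  leaves a tiling below \<open>a DU b\<close>. Otherwise the tile of that cell passes through it as a peak;
  by cover-inclusiveness so does every tile meeting the same antidiagonal further down, and so
  does the lower path, hence the peaks can all be contracted simultaneously to give a tiling
  below \<open>a b\<close>. Thus \<open>F(a UD b) = F(a b) + q F(a DU b)\<close>, and moving the first peak
  \<open>U^(h+1) D b\<close> towards the axis gives \<open>F(U^(h+1) D b) = [h+1] F(U^h b)\<close>.\<close>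

section \<open>Balance and height of lattice paths\<close>

text \<open>The first peak is chosen because only up steps precede it. Pushing it down turns U^h UD
  b into U^h DU b = U^(h-1) UD (U b), and contracting the pushed peak yields U^h b once more. So
  every push contributes a power of q times the same F(U^h b), and these powers add up to [h+1]. At
  the axis the pushed path is DU b, which is not a Dyck path. Tilings are therefore defined under
  arbitrary upper words; the sum for DU b is empty, and this ends the recursion. All tiles are
  contracted by one map of the plane whose preimages reinsert the peaks. Preimages commute with the
  set operations and with the translation by (1,-1), so only the shape of a single tile needs a
  separate argument. Paths are compared by their heights along antidiagonals: inserting a peak then
  moves later heights by two positions and changes nothing else.\<close>

definition bal :: "bool list \<Rightarrow> int" where
  "bal w = int (ups w) - int (downs w)"

text \<open>Positions are integers because a cell (x, y) is tested at x + y + 1. Outside the word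
  the height is 0 on the left and \<open>bal w\<close> on the right, so heights can be compared at
  all p.\<close>

definition hgt :: "bool list \<Rightarrow> int \<Rightarrow> int" where
  "hgt w p = bal (take (nat p) w)"

lemma ups_simps [simp]:
  "ups [] = 0" "ups (s # w) = (if s then Suc (ups w) else ups w)" "ups (u @ v) = ups u + ups v"
  by (auto simp: ups_def)

lemma downs_simps [simp]:
  "downs [] = 0" "downs (s # w) = (if s then downs w else Suc (downs w))"
  "downs (u @ v) = downs u + downs v"
  by (auto simp: downs_def)

lemma ups_plus_downs: "ups w + downs w = length w"
  by (induction w) auto

lemma bal_simps [simp]:
  "bal [] = 0" "bal (s # w) = (if s then bal w + 1 else bal w - 1)" "bal (u @ v) = bal u + bal v"
  by (auto simp: bal_def)

lemma abs_bal_le: "\<bar>bal w\<bar> \<le> int (length w)"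
  using ups_plus_downs[of w] by (auto simp: bal_def)

lemma bal_parity: "even (bal w + int (length w))"
  using ups_plus_downs[of w] by (auto simp: bal_def simp flip: of_nat_add)

lemma is_dyck_iff: "is_dyck w \<longleftrightarrow> bal w = 0 \<and> (\<forall>p. 0 \<le> hgt w p)"
proof -
  have "(\<forall>k\<le>length w. downs (take k w) \<le> ups (take k w)) \<longleftrightarrow> (\<forall>p. 0 \<le> hgt w p)" if "bal w = 0"
  proof
    assume *: "\<forall>k\<le>length w. downs (take k w) \<le> ups (take k w)"
    show "\<forall>p. 0 \<le> hgt w p"
    proof
      fix p
      show "0 \<le> hgt w p"
        using * that by (cases "nat p \<le> length w") (auto simp: hgt_def bal_def)
    qed
  next
    assume *: "\<forall>p. 0 \<le> hgt w p"
    show "\<forall>k\<le>length w. downs (take k w) \<le> ups (take k w)"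
    proof (intro allI impI)
      fix k
      show "downs (take k w) \<le> ups (take k w)"
        using *[rule_format, of "int k"] by (auto simp: hgt_def bal_def)
    qed
  qed
  then show ?thesis by (auto simp: is_dyck_def bal_def)
qed

lemma is_dyck_bal: "is_dyck w \<Longrightarrow> bal w = 0"
  and is_dyck_hgt: "is_dyck w \<Longrightarrow> 0 \<le> hgt w p"
  by (auto simp: is_dyck_iff)

lemma is_dyck_prefix: "is_dyck (u @ v) \<Longrightarrow> 0 \<le> bal u"
  using is_dyck_hgt[of "u @ v" "int (length u)"] by (simp add: hgt_def)

lemma hgt_parity:
  assumes "0 \<le> p" "p \<le> int (length w)"
  shows "even (hgt w p + p)"
proof -
  have "length (take (nat p) w) = nat p" using assms by simp
  then show ?thesis using bal_parity[of "take (nat p) w"] assms by (simp add: hgt_def)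
qed

lemma hgt_step:
  assumes "0 \<le> p" "p < int (length w)"
  shows "hgt w (p + 1) = hgt w p + (if w ! nat p then 1 else - 1)"
proof -
  have "nat (p + 1) = Suc (nat p)" "nat p < length w" using assms by auto
  then show ?thesis by (simp add: hgt_def take_Suc_conv_app_nth)
qed

lemma hgt_le: "0 \<le> p \<Longrightarrow> hgt w p \<le> p"
  using abs_bal_le[of "take (nat p) w"] by (auto simp: hgt_def)

lemma hgt_le_rev:
  assumes "bal w = 0" "0 \<le> p" "p \<le> int (length w)"
  shows "hgt w p \<le> int (length w) - p"
proof -
  have "bal (take (nat p) w) + bal (drop (nat p) w) = 0"
    using assms(1) by (metis append_take_drop_id bal_simps(3))
  then show ?thesis using abs_bal_le[of "drop (nat p) w"] assms(2,3) by (auto simp: hgt_def)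
qed

lemma hgt_nonpos [simp]: "p \<le> 0 \<Longrightarrow> hgt w p = 0"
  by (simp add: hgt_def)

lemma hgt_beyond: "int (length w) \<le> p \<Longrightarrow> hgt w p = bal w"
  by (simp add: hgt_def)

lemma hgt_peak:
  assumes "length u = s"
  shows "hgt (u @ True # False # v) p =
    (if p \<le> int s then hgt (u @ v) p
     else if p = int s + 1 then hgt (u @ v) (int s) + 1 else hgt (u @ v) (p - 2))"
proof -
  consider "p \<le> int s" | "p = int s + 1" | "int s + 2 \<le> p" by linarith
  then show ?thesis
  proof cases
    case 2
    then have "nat p = Suc s" by auto
    then show ?thesis using 2 assms by (simp add: hgt_def)
  next
    case 3
    then obtain k where "p = int (s + k + 2)"
      by (metis zle_iff_zadd of_nat_add of_nat_numeral add.assoc add.commute)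
    then have "nat p = Suc (Suc (s + k))" "nat (p - 2) = s + k" by auto
    then show ?thesis using 3 assms by (simp add: hgt_def)
  qed (use assms in \<open>simp add: hgt_def\<close>)
qed

lemma hgt_valley:
  assumes "length u = s"
  shows "hgt (u @ False # True # v) p =
    (if p = int s + 1 then hgt (u @ True # False # v) p - 2 else hgt (u @ True # False # v) p)"
proof -
  consider "p \<le> int s" | "p = int s + 1" | "int s + 2 \<le> p" by linarith
  then show ?thesis
  proof cases
    case 2
    then have "nat p = Suc s" by auto
    then show ?thesis using 2 assms by (simp add: hgt_def)
  next
    case 3
    then obtain k where "p = int (s + k + 2)"
      by (metis zle_iff_zadd of_nat_add of_nat_numeral add.assoc add.commute)
    then have "nat p = Suc (Suc (s + k))" by auto
    then show ?thesis using 3 assms by (simp add: hgt_def)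
  qed (use assms in \<open>simp add: hgt_def\<close>)
qed

lemma hgt_peak_le_iff:
  assumes "length u = s" "length u' = s"
  shows "(\<forall>p. hgt (u @ True # False # v) p \<le> hgt (u' @ True # False # v') p) \<longleftrightarrow>
    (\<forall>p. hgt (u @ v) p \<le> hgt (u' @ v') p)" (is "?L \<longleftrightarrow> ?R")
proof
  assume L: ?L
  show ?R
  proof
    fix p
    show "hgt (u @ v) p \<le> hgt (u' @ v') p"
      \<comment> \<open>Position p of the contracted word survives at p if p \<le> s and at p + 2
        otherwise.\<close>
      using L[rule_format, of p] L[rule_format, of "p + 2"] assms
      by (auto simp: hgt_peak split: if_splits)
  qed
qed (use assms in \<open>auto simp: hgt_peak\<close>)

lemma is_dyck_peak_iff: "is_dyck (u @ True # False # v) \<longleftrightarrow> is_dyck (u @ v)"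
proof -
  have "(\<forall>p. 0 \<le> hgt (u @ True # False # v) p) \<longleftrightarrow> (\<forall>p. 0 \<le> hgt (u @ v) p)" (is "?L \<longleftrightarrow> ?R")
  proof
    assume L: ?L
    show ?R
    proof
      fix p
      show "0 \<le> hgt (u @ v) p"
        using L[rule_format, of p] L[rule_format, of "p + 2"]
        by (auto simp: hgt_peak[OF refl] split: if_splits)
    qed
  next
    assume R: ?R
    then show ?L using R[rule_format, of "int (length u)"] by (auto simp: hgt_peak[OF refl])
  qed
  then show ?thesis by (simp add: is_dyck_iff)
qed

lemma dyck_paths_peak_iff: "u @ True # False # v \<in> dyck_paths (Suc n) \<longleftrightarrow> u @ v \<in> dyck_paths n"
  by (auto simp: dyck_paths_def is_dyck_peak_iff)


section \<open>Trails of cells\<close>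

text \<open>The recursive form of the cell set in \<open>dyck_tile\<close>, with the starting cell
  as a parameter so that a tile can be cut at any step.\<close>

fun trail :: "int \<Rightarrow> int \<Rightarrow> bool list \<Rightarrow> (int \<times> int) set" where
  "trail a b [] = {(a, b)}"
| "trail a b (s # w) = insert (a, b) (if s then trail a (b + 1) w else trail (a + 1) b w)"

lemma mem_trail_iff:
  "z \<in> trail a b w \<longleftrightarrow> (\<exists>u v. w = u @ v \<and> z = (a + int (downs u), b + int (ups u)))"
proof (induction w arbitrary: a b)
  case (Cons s w)
  have "(\<exists>u v. s # w = u @ v \<and> z = (a + int (downs u), b + int (ups u))) \<longleftrightarrow>
    z = (a, b) \<or> (\<exists>u v. w = u @ v \<and> z = (a + int (downs (s # u)), b + int (ups (s # u))))"
    (is "?L \<longleftrightarrow> ?R")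
  proof
    assume ?L
    then obtain u v where "s # w = u @ v" "z = (a + int (downs u), b + int (ups u))" by blast
    then show ?R by (cases u) auto
  next
    assume ?R
    then show ?L
    proof
      assume "z = (a, b)"
      then show ?L by (intro exI[of _ "[]"] exI[of _ "s # w"]) auto
    next
      assume "\<exists>u v. w = u @ v \<and> z = (a + int (downs (s # u)), b + int (ups (s # u)))"
      then obtain u v where "w = u @ v" "z = (a + int (downs (s # u)), b + int (ups (s # u)))"
        by blast
      then show ?L by (intro exI[of _ "s # u"] exI[of _ v]) simp
    qed
  qed
  then show ?case by (auto simp: Cons.IH algebra_simps)
qed auto

lemma dyck_tile_iff: "dyck_tile T \<longleftrightarrow> (\<exists>a b w. is_dyck w \<and> T = trail a b w)"
proof -
  have "{(a + int (downs (take k w)), b + int (ups (take k w))) | k. k \<le> length w} = trail a b w"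
    for a b w
  proof (intro set_eqI iffI)
    fix z assume "z \<in> {(a + int (downs (take k w)), b + int (ups (take k w))) | k. k \<le> length w}"
    then obtain k where "z = (a + int (downs (take k w)), b + int (ups (take k w)))" by blast
    then show "z \<in> trail a b w" unfolding mem_trail_iff
      by (intro exI[of _ "take k w"] exI[of _ "drop k w"]) simp
  next
    fix z assume "z \<in> trail a b w"
    then obtain u v where *: "w = u @ v" "z = (a + int (downs u), b + int (ups u))"
      unfolding mem_trail_iff by blast
    then show "z \<in> {(a + int (downs (take k w)), b + int (ups (take k w))) | k. k \<le> length w}"
      by (auto intro!: exI[of _ "length u"])
  qed
  then show ?thesis by (simp add: dyck_tile_def)
qed

lemma trail_append: "trail a b (u @ v) = trail a b u \<union> trail (a + int (downs u)) (b + int (ups u)) v"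
proof (induction u arbitrary: a b)
  case Nil
  then show ?case by (cases v) auto
next
  case (Cons s u)
  then show ?case by (auto simp: algebra_simps)
qed

lemma start_in_trail [simp]: "(a, b) \<in> trail a b w"
  by (cases w) auto

lemma trail_range:
  "(x, y) \<in> trail a b w \<Longrightarrow> a + b \<le> x + y \<and> x + y \<le> a + b + int (length w)"
  by (induction w arbitrary: a b) (force split: if_splits)+

lemma trail_at:
  assumes "a + b \<le> t" "t \<le> a + b + int (length w)"
  shows "\<exists>x y. (x, y) \<in> trail a b w \<and> x + y = t"
proof -
  have k: "nat (t - a - b) \<le> length w" using assms by auto
  let ?u = "take (nat (t - a - b)) w"
  have "(a + int (downs ?u), b + int (ups ?u)) \<in> trail a b w"
    unfolding mem_trail_iff by (metis append_take_drop_id)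
  moreover have "int (ups ?u + downs ?u) = t - a - b"
    unfolding ups_plus_downs using k assms by simp
  ultimately show ?thesis by (intro exI conjI) auto
qed

text \<open>Every step raises x + y by one, so the antidiagonal of a cell fixes the length of the
  prefix leading to it.\<close>

lemma trail_inj:
  assumes "(x, y) \<in> trail a b w" "(x', y') \<in> trail a b w" "x + y = x' + y'"
  shows "(x, y) = (x', y')"
proof -
  obtain u v where u: "w = u @ v" "x = a + int (downs u)" "y = b + int (ups u)"
    using assms(1) unfolding mem_trail_iff by auto
  obtain u' v' where u': "w = u' @ v'" "x' = a + int (downs u')" "y' = b + int (ups u')"
    using assms(2) unfolding mem_trail_iff by auto
  have "int (ups u + downs u) = int (ups u' + downs u')" using u u' assms(3) by simp
  then have "length u = length u'" by (simp only: ups_plus_downs of_nat_eq_iff)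
  then have "u = u'" using u(1) u'(1) by simp
  then show ?thesis using u u' by simp
qed

lemma trail_translate: "(x, y) \<in> trail (a + c) (b + d) w \<longleftrightarrow> (x - c, y - d) \<in> trail a b w"
  by (auto simp: mem_trail_iff algebra_simps)

lemma dyck_tile_inj:
  "dyck_tile T \<Longrightarrow> (x, y) \<in> T \<Longrightarrow> (x', y') \<in> T \<Longrightarrow> x + y = x' + y' \<Longrightarrow> x = x' \<and> y = y'"
  unfolding dyck_tile_iff using trail_inj by blast

lemma dyck_tile_nonempty: "dyck_tile T \<Longrightarrow> T \<noteq> {}"
  unfolding dyck_tile_iff using start_in_trail by blast

lemma dyck_tile_singleton: "dyck_tile {(x, y)}"
  unfolding dyck_tile_iff by (intro exI[of _ x] exI[of _ y] exI[of _ "[]"]) (simp add: is_dyck_iff hgt_def)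

text \<open>Without its left and upper neighbours in T, the cell can only be entered by an up step
  and left by a down step. It is not an end of T, since a nonempty Dyck word neither ends with an up
  step nor starts with a down step.\<close>

lemma dyck_tile_through_peak:
  assumes "dyck_tile T" "(x, y) \<in> T" "T \<noteq> {(x, y)}" "(x - 1, y) \<notin> T" "(x, y + 1) \<notin> T"
  shows "(x, y - 1) \<in> T" "(x + 1, y) \<in> T"
proof -
  obtain a b w where w: "is_dyck w" "T = trail a b w"
    using assms(1) by (auto simp: dyck_tile_iff)
  obtain u v where u: "w = u @ v" "x = a + int (downs u)" "y = b + int (ups u)"
    using assms(2) unfolding w(2) mem_trail_iff by auto
  have last_up: "\<exists>u'. u = u' @ [True]" if nonempty: "u \<noteq> []"
  proof -
    obtain u' l where l: "u = u' @ [l]" using nonempty by (cases u rule: rev_cases) auto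
    have "(x - 1, y) \<in> T" if "\<not> l"
      unfolding w(2) mem_trail_iff
      by (rule exI[of _ u'], rule exI[of _ "l # v"]) (use u l that in auto)
    then show ?thesis using l assms(4) by auto
  qed
  have v: "\<exists>v'. v = False # v'"
  proof (cases v)
    case Nil
    have "u \<noteq> []" using Nil u w(2) assms(3) by auto
    then obtain u' where "u = u' @ [True]" using last_up by blast
    then have "bal u' < 0" using is_dyck_bal[OF w(1)] u Nil by simp
    moreover have "0 \<le> bal u'" using is_dyck_prefix[of u' "True # v"] w(1) u(1) \<open>u = u' @ [True]\<close> by simp
    ultimately show ?thesis by simp
  next
    case (Cons s v')
    have "(x, y + 1) \<in> T" if s
      unfolding w(2) mem_trail_iff
      by (rule exI[of _ "u @ [s]"], rule exI[of _ v']) (use u Cons that in auto)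
    then show ?thesis using Cons assms(5) by auto
  qed
  then obtain v' where v': "v = False # v'" by blast
  show "(x + 1, y) \<in> T"
    unfolding w(2) mem_trail_iff
    by (rule exI[of _ "u @ [False]"], rule exI[of _ v']) (use u v' in auto)
  have "0 \<le> bal (u @ [False])" using is_dyck_prefix[of "u @ [False]" v'] w(1) u(1) v' by simp
  then have "u \<noteq> []" by auto
  then obtain u' where u': "u = u' @ [True]" using last_up by blast
  show "(x, y - 1) \<in> T"
    unfolding w(2) mem_trail_iff
    by (rule exI[of _ u'], rule exI[of _ "True # v"]) (use u u' in auto)
qed

section \<open>Squeezing and widening\<close>

text \<open>The antidiagonals \<open>x + y = s - 1, s, s + 1\<close> are identified along the shape of a peak;
  taking preimages inserts a peak into every tile that meets the antidiagonal \<open>x + y = s - 1\<close>.\<close>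

definition squeeze :: "int \<Rightarrow> int \<times> int \<Rightarrow> int \<times> int" where
  "squeeze s = (\<lambda>(x, y). if x + y < s then (x, y) else if x + y = s then (x, y - 1) else (x - 1, y - 1))"

text \<open>A section of \<open>squeeze s\<close> that skips the antidiagonals s and s + 1;
  preimages under it are the contracted tiles.\<close>

definition widen :: "int \<Rightarrow> int \<times> int \<Rightarrow> int \<times> int" where
  "widen s = (\<lambda>(x, y). if x + y < s then (x, y) else (x + 1, y + 1))"

lemma squeeze_widen [simp]: "squeeze s (widen s z) = z"
  by (cases z) (auto simp: squeeze_def widen_def)

text \<open>Surjectivity makes preimages lose no information: equality, inclusion and emptiness are
  reflected.\<close>

lemma surj_squeeze: "surj (squeeze s)"
  by (metis squeeze_widen surjI)

lemma vimage_squeeze_eq_iff [simp]: "squeeze s -` A = squeeze s -` B \<longleftrightarrow> A = B"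
  using surj_squeeze by (metis surj_image_vimage_eq)

lemma vimage_squeeze_subset_iff: "squeeze s -` A \<subseteq> squeeze s -` B \<longleftrightarrow> A \<subseteq> B"
  using surj_squeeze by (metis surj_image_vimage_eq image_mono vimage_mono)

lemma vimage_squeeze_empty_iff: "squeeze s -` A = {} \<longleftrightarrow> A = {}"
  using vimage_squeeze_eq_iff[of s A "{}"] by simp

lemma inj_vimage_squeeze: "inj (vimage (squeeze s))"
  by (rule injI) simp

lemma mem_shift_iff: "(x, y) \<in> shift T \<longleftrightarrow> (x - 1, y + 1) \<in> T"
  by (force simp: shift_def)

text \<open>On each antidiagonal \<open>squeeze s\<close> is a translation, and \<open>shift\<close>
  keeps x + y, so the two commute. This is what transports cover-inclusiveness.\<close>

lemma shift_vimage_squeeze: "shift (squeeze s -` T) = squeeze s -` shift T"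
  by (auto simp: mem_shift_iff squeeze_def)

lemma vimage_squeeze_trail_before:
  assumes "a + b + int (length w) < s - 1"
  shows "squeeze s -` trail a b w = trail a b w"
proof -
  have "(x, y) \<in> trail a b w" if "(x, y) \<in> squeeze s -` trail a b w" for x y
    using that assms by (auto simp: squeeze_def split: if_splits dest!: trail_range)
  moreover have "(x, y) \<in> squeeze s -` trail a b w" if "(x, y) \<in> trail a b w" for x y
    using that assms trail_range[OF that] by (auto simp: squeeze_def)
  ultimately show ?thesis by (intro set_eqI iffI; case_tac x; simp only:)
qed

lemma vimage_squeeze_trail_after:
  assumes "s - 1 < a + b"
  shows "squeeze s -` trail a b w = trail (a + 1) (b + 1) w"
proof -
  have "(x, y) \<in> trail (a + 1) (b + 1) w" if "(x, y) \<in> squeeze s -` trail a b w" for x y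
    using that assms unfolding trail_translate
    by (auto simp: squeeze_def split: if_splits dest: trail_range)
  moreover have "(x, y) \<in> squeeze s -` trail a b w" if "(x, y) \<in> trail (a + 1) (b + 1) w" for x y
    using that assms trail_range[OF that] unfolding trail_translate
    by (auto simp: squeeze_def)
  ultimately show ?thesis by (intro set_eqI iffI; case_tac x; simp only:)
qed

text \<open>The cell reached after u lies on x + y = s - 1. Its fibre under \<open>squeeze s\<close>
  is the cell itself, the cell above it and the right neighbour of the latter, which is exactly an
  up step followed by a down step.\<close>

lemma vimage_squeeze_trail_at:
  assumes "a + b + int (length u) = s - 1"
  shows "squeeze s -` trail a b (u @ v) = trail a b (u @ True # False # v)"
proof -
  define x0 y0 where "x0 = a + int (downs u)" and "y0 = b + int (ups u)"
  have sum: "x0 + y0 = s - 1" using ups_plus_downs[of u] assms by (simp add: x0_def y0_def)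
  have end_u: "(x0, y0) \<in> trail a b u"
    unfolding mem_trail_iff x0_def y0_def by (intro exI[of _ u] exI[of _ "[]"]) simp
  have u: "x + y \<le> s - 1 \<and> (x + y = s - 1 \<longrightarrow> x = x0 \<and> y = y0)" if "(x, y) \<in> trail a b u" for x y
    using trail_range[OF that] assms trail_inj[OF that end_u] sum by auto
  have v: "s - 1 \<le> x + y \<and> (x + y = s - 1 \<longrightarrow> x = x0 \<and> y = y0)" if "(x, y) \<in> trail x0 y0 v" for x y
    using trail_range[OF that] trail_inj[OF that start_in_trail] sum by auto
  have orig: "trail a b (u @ v) = trail a b u \<union> trail x0 y0 v"
    by (simp add: trail_append x0_def y0_def)
  have new: "trail a b (u @ True # False # v) =
      trail a b u \<union> {(x0, y0 + 1)} \<union> {(x, y). (x - 1, y - 1) \<in> trail x0 y0 v}"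
    using end_u trail_translate[of _ _ x0 1 y0 1 v] by (auto simp: trail_append x0_def y0_def)
  show ?thesis unfolding orig new
  proof (intro set_eqI iffI)
    fix z
    assume z: "z \<in> squeeze s -` (trail a b u \<union> trail x0 y0 v)"
    obtain x y where xy: "z = (x, y)" by (cases z)
    have "(x, y) = (x0, y0 + 1)"
      if "(x - 1, y - 1) \<notin> trail x0 y0 v" "(x, y) \<notin> trail a b u"
      using z that sum by (auto simp: xy squeeze_def end_u split: if_splits dest!: u v)
    then show "z \<in> trail a b u \<union> {(x0, y0 + 1)} \<union> {(x, y). (x - 1, y - 1) \<in> trail x0 y0 v}"
      unfolding xy by blast
  next
    fix z
    assume z: "z \<in> trail a b u \<union> {(x0, y0 + 1)} \<union> {(x, y). (x - 1, y - 1) \<in> trail x0 y0 v}"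
    obtain x y where xy: "z = (x, y)" by (cases z)
    from z consider "(x, y) \<in> trail a b u" | "(x, y) = (x0, y0 + 1)" | "(x - 1, y - 1) \<in> trail x0 y0 v"
      unfolding xy by auto
    then show "z \<in> squeeze s -` (trail a b u \<union> trail x0 y0 v)"
    proof cases
      case 1
      then show ?thesis using u[OF 1] by (auto simp: xy squeeze_def)
    next
      case 2
      then show ?thesis using sum end_u by (auto simp: xy squeeze_def)
    next
      case 3
      then show ?thesis using v[OF 3] by (auto simp: xy squeeze_def)
    qed
  qed
qed

lemma trail_next:
  "(x, y + 1) \<in> trail x y v \<Longrightarrow> \<exists>v'. v = True # v'"
  "(x + 1, y) \<in> trail x y v \<Longrightarrow> \<exists>v'. v = False # v'"
  by (cases v; auto split: if_splits dest: trail_inj[OF start_in_trail])+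

text \<open>For the converse, a preimage consists of whole fibres, so a trail that meets x + y = s -
  1 continues there with an up and a down step, and this peak can be deleted.\<close>

lemma dyck_tile_vimage_squeeze [simp]: "dyck_tile (squeeze s -` T) \<longleftrightarrow> dyck_tile T"
proof
  assume "dyck_tile T"
  then obtain a b w where w: "is_dyck w" "T = trail a b w" by (auto simp: dyck_tile_iff)
  consider "a + b + int (length w) < s - 1" | "s - 1 < a + b"
    | "a + b \<le> s - 1" "s - 1 \<le> a + b + int (length w)" by linarith
  then show "dyck_tile (squeeze s -` T)"
  proof cases
    case 1
    then show ?thesis using w vimage_squeeze_trail_before by (metis dyck_tile_iff)
  next
    case 2
    then show ?thesis using w vimage_squeeze_trail_after by (metis dyck_tile_iff)
  next
    case 3
    define u v where "u = take (nat (s - 1 - a - b)) w" and "v = drop (nat (s - 1 - a - b)) w"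
    have "w = u @ v" "a + b + int (length u) = s - 1" using 3 by (auto simp: u_def v_def)
    then show ?thesis using w vimage_squeeze_trail_at is_dyck_peak_iff by (metis dyck_tile_iff)
  qed
next
  assume "dyck_tile (squeeze s -` T)"
  then obtain a b w where w: "is_dyck w" "squeeze s -` T = trail a b w" by (auto simp: dyck_tile_iff)
  have mem: "(x, y) \<in> trail a b w \<longleftrightarrow> squeeze s (x, y) \<in> T" for x y
    unfolding w(2)[symmetric] by simp
  show "dyck_tile T"
  proof (cases "a + b \<le> s - 1 \<and> s - 1 \<le> a + b + int (length w)")
    case True
    then obtain x y where xy: "(x, y) \<in> trail a b w" "x + y = s - 1" using trail_at by blast
    obtain u v where u: "w = u @ v" "x = a + int (downs u)" "y = b + int (ups u)"
      using xy(1) unfolding mem_trail_iff by auto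
    have len: "a + b + int (length u) = s - 1" using ups_plus_downs[of u] u xy by simp
    have later: "(x', y') \<in> trail x y v" if "(x', y') \<in> trail a b w" "s \<le> x' + y'" for x' y'
      using that trail_range[of x' y' a b u] len unfolding u(1) trail_append u(2,3) by auto
    have "(x, y + 1) \<in> trail a b w" "(x + 1, y + 1) \<in> trail a b w"
      using xy unfolding mem by (auto simp: squeeze_def)
    then have *: "(x, y + 1) \<in> trail x y v" "(x + 1, y + 1) \<in> trail x y v" using later xy(2) by auto
    then obtain v1 where v1: "v = True # v1" using trail_next by blast
    then have "(x + 1, y + 1) \<in> trail x (y + 1) v1" using *(2) by auto
    then obtain v2 where v2: "v1 = False # v2" using trail_next by blast
    have "squeeze s -` T = squeeze s -` trail a b (u @ v2)"
      unfolding w(2) vimage_squeeze_trail_at[OF len] u(1) v1 v2 ..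
    moreover have "is_dyck (u @ v2)" using w(1) u(1) v1 v2 by (simp add: is_dyck_peak_iff)
    ultimately show ?thesis by (auto simp: dyck_tile_iff)
  next
    case False
    then consider "a + b + int (length w) < s - 1" | "s - 1 < a + b" by linarith
    then show ?thesis
    proof cases
      case 1
      then show ?thesis using w vimage_squeeze_trail_before by (metis dyck_tile_iff vimage_squeeze_eq_iff)
    next
      case 2
      have start: "squeeze s (a, b) \<in> T" using mem by (metis start_in_trail)
      \<comment> \<open>A trail cannot start on x + y = s or s + 1, because the fibre of its
        starting cell contains an earlier cell.\<close>
      have "a + b \<noteq> s"
      proof
        assume "a + b = s"
        then have "(a, b - 1) \<in> trail a b w" using start unfolding mem by (auto simp: squeeze_def)
        then show False by (auto dest: trail_range)
      qed
      moreover have "a + b \<noteq> s + 1"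
      proof
        assume "a + b = s + 1"
        then have "(a - 1, b - 1) \<in> trail a b w" using start unfolding mem by (auto simp: squeeze_def)
        then show False by (auto dest: trail_range)
      qed
      ultimately have "s - 1 < (a - 1) + (b - 1)" using 2 by linarith
      from vimage_squeeze_trail_after[OF this, of w]
      have "squeeze s -` T = squeeze s -` trail (a - 1) (b - 1) w" by (simp add: w(2))
      then show ?thesis using w(1) by (auto simp: dyck_tile_iff)
    qed
  qed
qed


section \<open>Tilings of the region between two paths\<close>

text \<open>The centre of the cell \<open>(x, y)\<close> lies at distance \<open>x + y + 1\<close> along a path and at height
  \<open>y - x\<close> above the diagonal.\<close>

definition region :: "bool list \<Rightarrow> bool list \<Rightarrow> (int \<times> int) set" where
  "region lam mu = {(x, y). hgt lam (x + y + 1) < y - x \<and> y - x < hgt mu (x + y + 1)}"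

text \<open>Formulated with heights and for arbitrary words, so that it also applies to an upper
  path with a valley below the axis.\<close>

definition tiling :: "bool list \<Rightarrow> bool list \<Rightarrow> (int \<times> int) set set \<Rightarrow> bool" where
  "tiling lam mu TT \<longleftrightarrow>
     (\<forall>p. hgt lam p \<le> hgt mu p) \<and> (\<forall>T \<in> TT. dyck_tile T) \<and> pairwise disjnt TT \<and>
     \<Union>TT = region lam mu \<and>
     (\<forall>T1 \<in> TT. \<forall>T2 \<in> TT. T1 \<noteq> T2 \<longrightarrow> shift T2 \<inter> T1 \<noteq> {} \<longrightarrow> shift T2 \<subseteq> T1)"

section \<open>Transport of tilings along the contraction\<close>

lemma region_peak:
  assumes "length u = s" "length u' = s"
  shows "region (u @ True # False # v) (u' @ True # False # v') =
    squeeze (int s) -` region (u @ v) (u' @ v')"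
  using assms by (auto simp: region_def hgt_peak squeeze_def algebra_simps split: if_splits)

text \<open>Preimages under \<open>squeeze\<close> respect unions, intersections,
  \<open>shift\<close> and the shape of Dyck tiles, and they are injective, so each clause of
  \<open>tiling\<close> is both preserved and reflected.\<close>

lemma tiling_peak_iff:
  assumes "length u = s" "length u' = s"
  shows "tiling (u @ True # False # v) (u' @ True # False # v') (vimage (squeeze (int s)) ` TT) \<longleftrightarrow>
    tiling (u @ v) (u' @ v') TT"
proof -
  let ?f = "vimage (squeeze (int s))"
  have "pairwise disjnt (?f ` TT) \<longleftrightarrow> pairwise disjnt TT"
    by (auto simp: pairwise_def disjnt_def vimage_squeeze_empty_iff simp flip: vimage_Int)
  moreover have "\<Union>(?f ` TT) = region (u @ True # False # v) (u' @ True # False # v') \<longleftrightarrow>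
      \<Union>TT = region (u @ v) (u' @ v')"
    unfolding region_peak[OF assms] by (simp flip: vimage_Union)
  ultimately show ?thesis
    by (simp add: tiling_def hgt_peak_le_iff[OF assms] shift_vimage_squeeze
        vimage_squeeze_subset_iff vimage_squeeze_empty_iff flip: vimage_Int)
qed

section \<open>Tilings in which the cell under the peak is not a tile\<close>

lemma hgt_at_peak:
  fixes a b :: "bool list"
  defines "mu \<equiv> a @ True # False # b"
  shows "hgt mu (int (length a)) = bal a" "hgt mu (int (length a) + 1) = bal a + 1"
    "hgt mu (int (length a) + 2) = bal a"
  unfolding mu_def by (simp_all add: hgt_peak[OF refl]) (simp_all add: hgt_def)

text \<open>The neighbours sought in T are the translates of those in the tile one cell higher on
  the antidiagonal. Only for the top cell do they come from the shape of the upper path.\<close>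

lemma tile_at_peak:
  assumes tl: "tiling lam (a @ True # False # b) TT"
    and no_single: "{(int (downs a), int (ups a))} \<notin> TT"
    and T: "T \<in> TT" "(x, y) \<in> T" and xy: "x + y = int (length a)"
  shows "(x, y - 1) \<in> T \<and> (x + 1, y) \<in> T"
proof -
  define x0 y0 where "x0 = int (downs a)" and "y0 = int (ups a)"
  let ?mu = "a @ True # False # b"
  have sum: "x0 + y0 = int (length a)" and d: "bal a = y0 - x0"
    using ups_plus_downs[of a] by (auto simp: x0_def y0_def bal_def)
  have Un: "\<Union>TT = region lam ?mu" and tile: "\<And>T. T \<in> TT \<Longrightarrow> dyck_tile T"
    and cover: "\<And>T1 T2. T1 \<in> TT \<Longrightarrow> T2 \<in> TT \<Longrightarrow> T1 \<noteq> T2 \<Longrightarrow> shift T2 \<inter> T1 \<noteq> {} \<Longrightarrow> shift T2 \<subseteq> T1"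
    using tl by (auto simp: tiling_def)
  \<comment> \<open>k counts the cells down the antidiagonal, starting at the one under the
    peak.\<close>
  have "(x0 + int k, y0 - int k - 1) \<in> T \<and> (x0 + int k + 1, y0 - int k) \<in> T"
    if "T \<in> TT" "(x0 + int k, y0 - int k) \<in> T" for k T
    using that
  proof (induction k arbitrary: T)
    case 0
    have "(x0 - 1, y0) \<notin> region lam ?mu" "(x0, y0 + 1) \<notin> region lam ?mu"
      using sum d hgt_at_peak[of a b] by (auto simp: region_def algebra_simps)
    then have "(x0 - 1, y0) \<notin> T" "(x0, y0 + 1) \<notin> T" using Un 0(1) by blast+
    moreover have "T \<noteq> {(x0, y0)}" using no_single 0(1) by (auto simp: x0_def y0_def)
    ultimately show ?case using dyck_tile_through_peak[OF tile[OF 0(1)]] 0(2) by simp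
  next
    case (Suc k)
    have "(x0 + int (Suc k), y0 - int (Suc k)) \<in> region lam ?mu" using Suc.prems Un by blast
    then have "(x0 + int k, y0 - int k) \<in> region lam ?mu"
      using hgt_at_peak[of a b] sum d by (auto simp: region_def algebra_simps)
    then obtain T' where T': "T' \<in> TT" "(x0 + int k, y0 - int k) \<in> T'" using Un by blast
    from Suc.IH[OF T'] have
      *: "(x0 + int (Suc k), y0 - int (Suc k) - 1) \<in> shift T'"
        "(x0 + int (Suc k) + 1, y0 - int (Suc k)) \<in> shift T'"
      by (auto simp: mem_shift_iff algebra_simps)
    have "T \<noteq> T'"
    proof
      assume "T = T'"
      from dyck_tile_inj[OF tile[OF T'(1)] T'(2), of "x0 + int (Suc k)" "y0 - int (Suc k)"]
      show False using Suc.prems(2) \<open>T = T'\<close> by simp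
    qed
    moreover have "(x0 + int (Suc k), y0 - int (Suc k)) \<in> shift T'"
      using T'(2) by (simp add: mem_shift_iff algebra_simps)
    ultimately have "shift T' \<subseteq> T" using cover[OF Suc.prems(1) T'(1)] Suc.prems(2) by blast
    then show ?case using * by blast
  qed
  note chain = this
  have "(x, y) \<in> region lam ?mu" using T Un by blast
  then have "y - x < y0 - x0 + 1" using hgt_at_peak[of a b] xy d by (auto simp: region_def)
  then have "x0 \<le> x" using sum xy by linarith
  then have "x = x0 + int (nat (x - x0))" "y = y0 - int (nat (x - x0))" using sum xy by auto
  then show ?thesis using chain[OF T(1), of "nat (x - x0)"] T(2) by (metis add.commute add.assoc)
qed

text \<open>If lam reaches the peak of mu, its neighbouring heights are bounded by those of mu.
  Otherwise the lowest cell above lam on the antidiagonal has its two neighbours in its tile, and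
  these must still lie above lam.\<close>

lemma lower_path_peak:
  assumes tl: "tiling lam (a @ True # False # b) TT"
    and no_single: "{(int (downs a), int (ups a))} \<notin> TT"
    and len: "length a + 2 \<le> length lam"
  shows "lam = take (length a) lam @ True # False # drop (length a + 2) lam"
proof -
  let ?mu = "a @ True # False # b"
  let ?s = "int (length a)"
  define t where "t = hgt lam (?s + 1)"
  have le: "\<And>p. hgt lam p \<le> hgt ?mu p" and Un: "\<Union>TT = region lam ?mu"
    using tl by (auto simp: tiling_def)
  have step: "t = hgt lam ?s + (if lam ! length a then 1 else - 1)"
    using hgt_step[of ?s lam] len by (simp add: t_def)
  have step': "hgt lam (?s + 2) = t + (if lam ! Suc (length a) then 1 else - 1)"
    using hgt_step[of "?s + 1" lam] len by (simp add: t_def nat_add_distrib add.commute[of _ 2])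
  have par: "even (t + ?s + 1)" using hgt_parity[of "?s + 1" lam] len by (simp add: t_def add.assoc)
  have "hgt lam ?s < t \<and> hgt lam (?s + 2) < t"
  proof (cases "bal a < t")
    case True
    then show ?thesis using le[of ?s] le[of "?s + 2"] hgt_at_peak[of a b] by linarith
  next
    case False
    have "t \<noteq> bal a" using par bal_parity[of a] by presburger
    then have "t < bal a" using False by simp
    \<comment> \<open>The lowest cell above lam on this antidiagonal satisfies x + y = s and y - x =
      t + 1, hence 2x = s - t - 1.\<close>
    have "even (?s - t - 1)" using par by presburger
    then obtain x where "?s - t - 1 = 2 * x" by (elim evenE)
    define y where "y = x + t + 1"
    have xy: "x + y = ?s" "y - x = t + 1" using \<open>?s - t - 1 = 2 * x\<close> by (auto simp: y_def)
    then have "(x, y) \<in> region lam ?mu"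
      using \<open>t < bal a\<close> hgt_at_peak[of a b] by (auto simp: region_def t_def)
    then obtain T where T: "T \<in> TT" "(x, y) \<in> T" using Un by blast
    have "(x, y - 1) \<in> region lam ?mu" "(x + 1, y) \<in> region lam ?mu"
      using tile_at_peak[OF tl no_single T xy(1)] T(1) Un by blast+
    moreover have "x + (y - 1) + 1 = ?s" "x + 1 + y + 1 = ?s + 2" using xy by auto
    ultimately show ?thesis using xy(2) by (auto simp: region_def add.commute[of _ 2])
  qed
  then have "lam ! length a" "\<not> lam ! Suc (length a)" using step step' by (auto split: if_splits)
  then have "drop (length a) lam = True # False # drop (length a + 2) lam"
    using len by (metis Cons_nth_drop_Suc add_2_eq_Suc' Suc_le_lessD Suc_lessD)
  then show ?thesis by (metis append_take_drop_id)
qed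

text \<open>A set is a preimage under \<open>squeeze\<close> iff it is a union of fibres, and by
  \<open>tile_at_peak\<close> no tile splits the three cells of a peak.\<close>

lemma tiling_at_peak_squeezed:
  assumes tl: "tiling (u @ True # False # v) (a @ True # False # b) TT"
    and no_single: "{(int (downs a), int (ups a))} \<notin> TT" and len: "length u = length a"
  shows "\<exists>TT'. TT = vimage (squeeze (int (length a))) ` TT'"
proof -
  let ?R = "region (u @ True # False # v) (a @ True # False # b)"
  let ?s = "int (length a)"
  have Un: "\<Union>TT = ?R" and disj: "pairwise disjnt TT" using tl by (auto simp: tiling_def)
  have reg: "(x, y - 1) \<in> ?R \<longleftrightarrow> (x, y) \<in> ?R" "(x + 1, y) \<in> ?R \<longleftrightarrow> (x, y) \<in> ?R"
    if "x + y = ?s" for x y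
    using that unfolding region_peak[OF len refl] by (auto simp: squeeze_def)
  have sat: "((x, y - 1) \<in> T \<longleftrightarrow> (x, y) \<in> T) \<and> ((x + 1, y) \<in> T \<longleftrightarrow> (x, y) \<in> T)"
    if T: "T \<in> TT" and xy: "x + y = ?s" for T x y
  proof (cases "(x, y) \<in> ?R")
    case True
    then obtain T' where T': "T' \<in> TT" "(x, y) \<in> T'" using Un by blast
    have T'': "(x, y - 1) \<in> T'" "(x + 1, y) \<in> T'" using tile_at_peak[OF tl no_single T' xy] by auto
    show ?thesis
    proof (cases "T = T'")
      case False
      then have "T \<inter> T' = {}" using disj T T'(1) by (auto simp: pairwise_def disjnt_def)
      then show ?thesis using T'(2) T'' by blast
    qed (use T'(2) T'' in simp)
  next
    case False
    then have "(x, y) \<notin> T" "(x, y - 1) \<notin> T" "(x + 1, y) \<notin> T" using reg[OF xy] T Un by blast+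
    then show ?thesis by simp
  qed
  have "squeeze ?s -` (widen ?s -` T) = T" if T: "T \<in> TT" for T
  proof -
    have "widen ?s (squeeze ?s (x, y)) \<in> T \<longleftrightarrow> (x, y) \<in> T" for x y
    proof -
      consider "x + y < ?s" | "x + y = ?s" | "x + y = ?s + 1" | "?s + 1 < x + y" by linarith
      then show ?thesis
      proof cases
        case 2
        then show ?thesis using sat[OF T 2] by (simp add: squeeze_def widen_def)
      next
        case 3
        then show ?thesis using sat[OF T, of "x - 1" y] by (simp add: squeeze_def widen_def)
      qed (simp_all add: squeeze_def widen_def)
    qed
    then show ?thesis by (simp add: set_eq_iff split_paired_All)
  qed
  then have "TT = vimage (squeeze ?s) ` (vimage (widen ?s) ` TT)"
    by (auto simp: image_image)
  then show ?thesis by blast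
qed

section \<open>Removing and adding the cell under the peak\<close>

lemma region_valley:
  "region lam (a @ False # True # b) =
    region lam (a @ True # False # b) - {(int (downs a), int (ups a))}"
proof -
  have sum: "int (downs a) + int (ups a) = int (length a)" "bal a = int (ups a) - int (downs a)"
    using ups_plus_downs[of a] by (auto simp: bal_def)
  \<comment> \<open>Both y - x and \<open>bal a\<close> have the parity of \<open>length a\<close>,
    so lowering the bound by two excludes only the height \<open>bal a\<close>.\<close>
  have "y - x < bal a - 1 \<longleftrightarrow> y - x < bal a + 1 \<and> \<not> (x = int (downs a) \<and> y = int (ups a))"
    if "x + y = int (length a)" for x y
    using that sum by presburger
  then show ?thesis
    using hgt_at_peak(2)[of a b] sum by (auto simp: region_def hgt_valley[OF refl] split: if_splits)
qed

lemma tiling_remove_single: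
  fixes a :: "bool list"
  defines "c \<equiv> (int (downs a), int (ups a))"
  assumes tl: "tiling lam (a @ True # False # b) TT" and c: "{c} \<in> TT"
  shows "tiling lam (a @ False # True # b) (TT - {{c}})"
proof -
  have Un: "\<Union>TT = region lam (a @ True # False # b)" and disj: "pairwise disjnt TT"
    using tl by (auto simp: tiling_def)
  have "c \<in> region lam (a @ True # False # b)" using Un c by blast
  then have "hgt lam (int (length a) + 1) < bal a"
    using ups_plus_downs[of a] by (auto simp: c_def region_def bal_def simp flip: of_nat_add add.commute)
  then have "\<forall>p. hgt lam p \<le> hgt (a @ False # True # b) p"
    using tl hgt_at_peak(2)[of a b] by (auto simp: tiling_def hgt_valley[OF refl])
  moreover have "\<Union>(TT - {{c}}) = region lam (a @ False # True # b)"
  proof -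
    have "c \<notin> T" if "T \<in> TT - {{c}}" for T
      using pairwiseD[OF disj, of T "{c}"] that c by (auto simp: disjnt_def)
    then have "\<Union>(TT - {{c}}) = \<Union>TT - {c}" by blast
    then show ?thesis using Un by (simp add: region_valley c_def)
  qed
  ultimately show ?thesis
    using tl pairwise_subset[OF disj, of "TT - {{c}}"] by (auto simp: tiling_def)
qed

text \<open>Cover-inclusiveness survives from both sides: the translate of {c} is a single cell, so
  meeting a tile means lying in it, and c is too high to belong to the translate of another
  tile.\<close>

lemma tiling_add_single:
  fixes a :: "bool list"
  defines "c \<equiv> (int (downs a), int (ups a))"
  assumes tl: "tiling lam (a @ False # True # b) TT"
  shows "{c} \<notin> TT" "tiling lam (a @ True # False # b) (insert {c} TT)"
proof -
  let ?mu = "a @ True # False # b" and ?mu' = "a @ False # True # b"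
  have Un: "\<Union>TT = region lam ?mu'" and disj: "pairwise disjnt TT"
    and le: "\<And>p. hgt lam p \<le> hgt ?mu' p" and tiles: "\<forall>T\<in>TT. dyck_tile T"
    and cover: "\<forall>T1\<in>TT. \<forall>T2\<in>TT. T1 \<noteq> T2 \<longrightarrow> shift T2 \<inter> T1 \<noteq> {} \<longrightarrow> shift T2 \<subseteq> T1"
    using tl by (simp_all add: tiling_def)
  have c_notin: "c \<notin> \<Union>TT" unfolding Un region_valley c_def by simp
  then show "{c} \<notin> TT" by blast
  have sum: "int (downs a) + int (ups a) = int (length a)" "bal a = int (ups a) - int (downs a)"
    using ups_plus_downs[of a] by (auto simp: bal_def)
  have "c \<in> region lam ?mu"
    using le[of "int (length a) + 1"] hgt_at_peak(2)[of a b] sum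
    by (auto simp: c_def region_def hgt_valley[OF refl])
  then have Un': "\<Union>(insert {c} TT) = region lam ?mu"
    using Un by (auto simp: region_valley c_def)
  have le': "hgt lam p \<le> hgt ?mu p" for p
    using le[of p] by (auto simp: hgt_valley[OF refl] split: if_splits)
  have above: "c \<notin> shift T" if "T \<in> TT" for T
  proof
    assume "c \<in> shift T"
    then have "(int (downs a) - 1, int (ups a) + 1) \<in> region lam ?mu'"
      using that Un by (auto simp: c_def mem_shift_iff)
    then have "int (ups a) + 1 - (int (downs a) - 1) <
        hgt ?mu (int (downs a) - 1 + (int (ups a) + 1) + 1)"
      unfolding region_valley unfolding region_def by blast
    also have "int (downs a) - 1 + (int (ups a) + 1) + 1 = int (length a) + 1" using sum by simp
    finally show False using hgt_at_peak(2)[of a b] sum by simp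
  qed
  have "pairwise disjnt (insert {c} TT)"
    using disj c_notin by (auto simp: pairwise_insert disjnt_def)
  moreover have "shift T2 \<subseteq> T1"
    if "T1 \<in> insert {c} TT" "T2 \<in> insert {c} TT" "T1 \<noteq> T2" "shift T2 \<inter> T1 \<noteq> {}" for T1 T2
  proof -
    consider "T1 \<in> TT" "T2 \<in> TT" | "T2 = {c}" | "T1 = {c}" "T2 \<in> TT" using \<open>T1 \<in> _\<close> \<open>T2 \<in> _\<close> by blast
    then show ?thesis
    proof cases
      case 1
      then show ?thesis using that(3,4) cover by blast
    next
      case 2
      then show ?thesis using that(4) by (auto simp: shift_def)
    next
      case 3
      then show ?thesis using that(4) above by auto
    qed
  qed
  moreover have "dyck_tile {c}" by (simp add: c_def dyck_tile_singleton)
  ultimately show "tiling lam ?mu (insert {c} TT)"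
    using tiles le' Un' unfolding tiling_def by simp
qed


section \<open>The recursion at a peak\<close>

definition tilings :: "nat \<Rightarrow> bool list \<Rightarrow> (bool list \<times> (int \<times> int) set set) set" where
  "tilings n mu = (SIGMA lam:dyck_paths n. {TT. tiling lam mu TT})"

definition tiling_sum :: "nat \<Rightarrow> bool list \<Rightarrow> 'a::comm_ring_1 \<Rightarrow> 'a" where
  "tiling_sum n mu q = (\<Sum>(lam, TT)\<in>tilings n mu. q ^ card TT)"

section \<open>Finiteness of the set of tilings\<close>

lemma region_bounds:
  assumes "lam \<in> dyck_paths n" "mu \<in> dyck_paths n" "(x, y) \<in> region lam mu"
  shows "0 \<le> x" "x < y" "y < int n"
proof -
  have dyck: "is_dyck lam" "is_dyck mu" "length lam = 2 * n" "length mu = 2 * n"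
    using assms by (auto simp: dyck_paths_def)
  have r: "hgt lam (x + y + 1) < y - x" "y - x < hgt mu (x + y + 1)"
    using assms(3) by (auto simp: region_def)
  show "x < y" using r(1) is_dyck_hgt[OF dyck(1), of "x + y + 1"] by linarith
  \<comment> \<open>A nonzero height of mu puts the position strictly between the ends of the path;
    there the height is at most the distance to either end, which confines the cell to the n by n
    square.\<close>
  then have "hgt mu (x + y + 1) \<noteq> 0" using r(2) by linarith
  then have "\<not> x + y + 1 \<le> 0" "\<not> 2 * int n \<le> x + y + 1"
    using hgt_nonpos hgt_beyond[of mu "x + y + 1"] is_dyck_bal[OF dyck(2)] dyck(4) by auto
  then have pos: "0 \<le> x + y + 1" "x + y + 1 \<le> 2 * int n" by auto
  show "0 \<le> x" using hgt_le[OF pos(1), of mu] r(2) by linarith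
  show "y < int n"
    using hgt_le_rev[of mu "x + y + 1"] is_dyck_bal[OF dyck(2)] dyck(4) pos r(2) by simp
qed

lemma finite_region:
  assumes "lam \<in> dyck_paths n" "mu \<in> dyck_paths n"
  shows "finite (region lam mu)"
proof (rule finite_subset)
  show "region lam mu \<subseteq> {0..int n} \<times> {0..int n}"
    using region_bounds[OF assms] by fastforce
qed simp

lemma finite_dyck_paths: "finite (dyck_paths n)"
  by (rule finite_subset[OF _ finite_lists_length_eq[of UNIV "2 * n"]]) (auto simp: dyck_paths_def)

lemma tiling_subset_Pow: "tiling lam mu TT \<Longrightarrow> TT \<subseteq> Pow (region lam mu)"
  by (auto simp: tiling_def)

lemma finite_tilings_between:
  assumes "lam \<in> dyck_paths n" "mu \<in> dyck_paths n"
  shows "finite {TT. tiling lam mu TT}"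
proof (rule finite_subset)
  show "{TT. tiling lam mu TT} \<subseteq> Pow (Pow (region lam mu))"
    using tiling_subset_Pow by blast
qed (simp add: finite_region[OF assms])

lemma finite_tilings: "mu \<in> dyck_paths n \<Longrightarrow> finite (tilings n mu)"
  unfolding tilings_def by (intro finite_SigmaI finite_dyck_paths finite_tilings_between)

lemma tilings_without_single:
  fixes a b :: "bool list"
  defines "c \<equiv> (int (downs a), int (ups a))" and "s \<equiv> length a"
  assumes mu: "a @ True # False # b \<in> dyck_paths (Suc n)"
  shows "{(lam, TT) \<in> tilings (Suc n) (a @ True # False # b). {c} \<notin> TT} =
    (\<lambda>(lam, TT). (take s lam @ True # False # drop s lam, vimage (squeeze (int s)) ` TT)) `
      tilings n (a @ b)" (is "?A = ?f ` _")
proof (intro equalityI subsetI)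
  have a_s: "length a = s" by (simp add: s_def)
  have s_le: "s \<le> 2 * n" using mu by (auto simp: dyck_paths_def s_def)
  fix z
  {
    assume "z \<in> ?A"
    then obtain lam TT where z: "z = (lam, TT)" and lam: "lam \<in> dyck_paths (Suc n)"
      and tl: "tiling lam (a @ True # False # b) TT" and c: "{c} \<notin> TT"
      by (auto simp: tilings_def)
    have len: "length a + 2 \<le> length lam" using lam s_le by (auto simp: dyck_paths_def s_def)
    define u v where "u = take (length a) lam" and "v = drop (length a + 2) lam"
    have lam_eq: "lam = u @ True # False # v"
      using lower_path_peak[OF tl c[unfolded c_def] len] by (simp add: u_def v_def)
    have u: "length u = length a" using len by (simp add: u_def)
    obtain TT' where TT': "TT = vimage (squeeze (int s)) ` TT'"
      using tiling_at_peak_squeezed[OF tl[unfolded lam_eq] c[unfolded c_def] u] unfolding s_def by blast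
    have "tiling (u @ v) (a @ b) TT'"
      using tl tiling_peak_iff[OF u refl] unfolding lam_eq TT' s_def by simp
    moreover have "u @ v \<in> dyck_paths n" using lam unfolding lam_eq dyck_paths_peak_iff .
    ultimately have "(u @ v, TT') \<in> tilings n (a @ b)" by (simp add: tilings_def)
    moreover have "z = ?f (u @ v, TT')" using u by (simp add: z lam_eq TT' s_def)
    ultimately show "z \<in> ?f ` tilings n (a @ b)" by blast
  next
    assume "z \<in> ?f ` tilings n (a @ b)"
    then obtain lam TT where z: "z = ?f (lam, TT)" and lam: "lam \<in> dyck_paths n"
      and tl: "tiling lam (a @ b) TT"
      by (auto simp: tilings_def)
    define u v where "u = take s lam" and "v = drop s lam"
    have lam_eq: "lam = u @ v" and u: "length u = s"
      using lam s_le by (auto simp: u_def v_def dyck_paths_def)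
    \<comment> \<open>The cell below c has the same image as c, so no preimage consists of c
      alone.\<close>
    have "{c} \<noteq> squeeze (int s) -` T" for T
    proof
      assume eq: "{c} = squeeze (int s) -` T"
      have "squeeze (int s) (int (downs a), int (ups a) - 1) = squeeze (int s) c"
        using ups_plus_downs[of a] by (auto simp: squeeze_def c_def s_def)
      then have "(int (downs a), int (ups a) - 1) \<in> {c}" using eq by (metis singletonI vimage_eq)
      then show False by (simp add: c_def)
    qed
    moreover have "tiling (u @ True # False # v) (a @ True # False # b) (vimage (squeeze (int s)) ` TT)"
      using tl tiling_peak_iff[OF u a_s] by (simp add: lam_eq)
    moreover have "u @ True # False # v \<in> dyck_paths (Suc n)"
      using lam unfolding lam_eq dyck_paths_peak_iff .
    ultimately show "z \<in> ?A" by (auto simp: z tilings_def u_def v_def)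
  }
qed

lemma tilings_with_single:
  fixes a b :: "bool list"
  defines "c \<equiv> (int (downs a), int (ups a))"
  shows "{(lam, TT) \<in> tilings n (a @ True # False # b). {c} \<in> TT} =
    (\<lambda>(lam, TT). (lam, insert {c} TT)) ` tilings n (a @ False # True # b)" (is "?A = ?f ` ?B")
proof (intro equalityI subsetI)
  fix z
  {
    assume "z \<in> ?A"
    then obtain lam TT where z: "z = (lam, TT)" and lam: "lam \<in> dyck_paths n"
      and tl: "tiling lam (a @ True # False # b) TT" and c: "{c} \<in> TT"
      by (auto simp: tilings_def)
    have "(lam, TT - {{c}}) \<in> ?B"
      using tiling_remove_single[OF tl c[unfolded c_def]] lam by (simp add: tilings_def c_def)
    moreover have "z = ?f (lam, TT - {{c}})" using c by (auto simp: z)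
    ultimately show "z \<in> ?f ` ?B" by blast
  next
    assume "z \<in> ?f ` ?B"
    then show "z \<in> ?A" by (auto simp: tilings_def c_def intro: tiling_add_single)
  }
qed

text \<open>Reinserting the peaks keeps the number of tiles, whereas adding {c} raises it by one;
  hence the factor q on the second term only.\<close>

lemma tiling_sum_peak:
  assumes mu: "a @ True # False # b \<in> dyck_paths (Suc n)"
  shows "tiling_sum (Suc n) (a @ True # False # b) q =
    tiling_sum n (a @ b) q + q * tiling_sum (Suc n) (a @ False # True # b) q"
proof -
  define c s where "c = (int (downs a), int (ups a))" and "s = length a"
  let ?M = "tilings (Suc n) (a @ True # False # b)"
  let ?A = "{(lam, TT) \<in> ?M. {c} \<notin> TT}" and ?B = "{(lam, TT) \<in> ?M. {c} \<in> TT}"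
  let ?w = "\<lambda>(lam :: bool list, TT :: (int \<times> int) set set). q ^ card TT"
  let ?f = "\<lambda>(lam, TT). (take s lam @ True # False # drop s lam, vimage (squeeze (int s)) ` TT)"
  let ?g = "\<lambda>(lam :: bool list, TT). (lam, insert {c} TT)"
  have finM: "finite ?M" using mu by (rule finite_tilings)
  have "tiling_sum (Suc n) (a @ True # False # b) q = sum ?w (?A \<union> ?B)"
    unfolding tiling_sum_def by (rule sum.cong) auto
  also have "\<dots> = sum ?w ?A + sum ?w ?B"
    by (rule sum.union_disjoint) (auto intro: finite_subset[OF _ finM])
  also have "sum ?w ?A = tiling_sum n (a @ b) q"
  proof -
    have s_le: "s \<le> 2 * n" using mu by (auto simp: dyck_paths_def s_def)
    have "inj_on ?f (tilings n (a @ b))"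
    proof (rule inj_onI, clarify)
      fix lam TT lam' TT'
      assume *: "(lam, TT) \<in> tilings n (a @ b)" "(lam', TT') \<in> tilings n (a @ b)"
        "take s lam @ True # False # drop s lam = take s lam' @ True # False # drop s lam'"
        "vimage (squeeze (int s)) ` TT = vimage (squeeze (int s)) ` TT'"
      then have "length (take s lam) = length (take s lam')"
        by (simp add: tilings_def dyck_paths_def)
      then have "take s lam = take s lam'" "drop s lam = drop s lam'" using *(3) by auto
      then show "lam = lam' \<and> TT = TT'"
        using *(4) inj_image_eq_iff[OF inj_vimage_squeeze] by (metis append_take_drop_id)
    qed
    then have "sum ?w (?f ` tilings n (a @ b)) = sum (?w \<circ> ?f) (tilings n (a @ b))"
      by (rule sum.reindex)
    also have "\<dots> = tiling_sum n (a @ b) q"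
      unfolding tiling_sum_def
      by (rule sum.cong) (auto simp: card_image inj_on_subset[OF inj_vimage_squeeze])
    finally show ?thesis using tilings_without_single[OF mu] by (simp add: c_def s_def)
  qed
  also have "sum ?w ?B = q * tiling_sum (Suc n) (a @ False # True # b) q"
  proof -
    let ?N = "tilings (Suc n) (a @ False # True # b)"
    \<comment> \<open>\<open>card\<close> grows by one only for a finite family. Finiteness comes
      from the region below a UD b, since a DU b need not be a Dyck path.\<close>
    have N: "{c} \<notin> TT \<and> finite TT" if "(lam, TT) \<in> ?N" for lam TT
    proof -
      have lam: "lam \<in> dyck_paths (Suc n)" and tl: "tiling lam (a @ False # True # b) TT"
        using that by (auto simp: tilings_def)
      have "finite (Pow (region lam (a @ True # False # b)))" using finite_region[OF lam mu] by simp
      then have "finite (insert {c} TT)"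
        using tiling_subset_Pow[OF tiling_add_single(2)[OF tl]] unfolding c_def by (rule rev_finite_subset)
      then show ?thesis using tiling_add_single(1)[OF tl] by (simp add: c_def)
    qed
    have "inj_on ?g ?N"
      by (rule inj_onI) (force dest!: N simp: insert_ident)
    then have "sum ?w (?g ` ?N) = sum (?w \<circ> ?g) ?N"
      by (rule sum.reindex)
    also have "\<dots> = (\<Sum>z\<in>?N. q * ?w z)"
      by (rule sum.cong) (auto dest!: N)
    also have "\<dots> = q * tiling_sum (Suc n) (a @ False # True # b) q"
      unfolding tiling_sum_def by (simp add: sum_distrib_left)
    finally show ?thesis using tilings_with_single[of "Suc n" a b] by (simp add: c_def)
  qed
  finally show ?thesis .
qed

text \<open>The upper word has height -1 at position 1, where no Dyck path can lie weakly below
  it.\<close>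

lemma tilings_below_axis: "tilings n (False # w) = {}"
proof -
  have "\<not> tiling lam (False # w) TT" if "is_dyck lam" for lam TT
  proof
    assume "tiling lam (False # w) TT"
    then have "hgt lam 1 \<le> hgt (False # w) 1" by (auto simp: tiling_def)
    then show False using is_dyck_hgt[OF that, of 1] by (simp add: hgt_def)
  qed
  then show ?thesis by (auto simp: tilings_def dyck_paths_def)
qed

lemma qint_Suc: "qint (Suc h) q = 1 + q * qint h q"
  unfolding qint_def by (subst sum.lessThan_Suc_shift) (simp add: sum_distrib_left)

lemma tiling_sum_first_peak:
  assumes "replicate h True @ True # False # b \<in> dyck_paths (Suc n)"
  shows "tiling_sum (Suc n) (replicate h True @ True # False # b) q =
    qint (Suc h) q * tiling_sum n (replicate h True @ b) q"
  using assms
proof (induction h arbitrary: b)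
  case 0
  then show ?case
    using tiling_sum_peak[of "[]" b n q]
    by (simp add: tiling_sum_def[of "Suc n" "False # True # b"] tilings_below_axis qint_def)
next
  case (Suc h)
  have shift_up: "replicate (Suc h) True @ w = replicate h True @ True # w" for w
    by (simp add: replicate_app_Cons_same)
  \<comment> \<open>The valley is regrouped as a peak one step earlier; its up step joins b, which
    is why the induction leaves b arbitrary.\<close>
  have "replicate h True @ True # False # True # b \<in> dyck_paths (Suc n)"
    using Suc.prems unfolding dyck_paths_peak_iff shift_up[of b] .
  note IH = Suc.IH[OF this]
  have "tiling_sum (Suc n) (replicate (Suc h) True @ True # False # b) q =
      tiling_sum n (replicate (Suc h) True @ b) q
      + q * tiling_sum (Suc n) (replicate (Suc h) True @ False # True # b) q"
    using Suc.prems by (rule tiling_sum_peak)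
  also have "\<dots> = (1 + q * qint (Suc h) q) * tiling_sum n (replicate (Suc h) True @ b) q"
    unfolding shift_up IH by (simp add: algebra_simps)
  finally show ?case by (simp only: qint_Suc[of "Suc h"])
qed


section \<open>The product over chords\<close>

text \<open>The product over chords read off their up steps, with h the height already reached;
  unlike the chord set, it follows the insertion of a peak by a simple recursion.\<close>

fun up_weight :: "int \<Rightarrow> bool list \<Rightarrow> 'a::comm_ring_1 \<Rightarrow> 'a" where
  "up_weight h [] q = 1"
| "up_weight h (s # w) q =
    (if s then qint (nat (h + 1)) q * up_weight (h + 1) w q else up_weight (h - 1) w q)"

text \<open>The inserted pair has balance 0, so later heights stay the same and only its own up step
  adds a factor.\<close>

lemma up_weight_peak:
  "up_weight h (a @ True # False # b) q = qint (nat (h + bal a + 1)) q * up_weight h (a @ b) q"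
  by (induction a arbitrary: h) (auto simp: algebra_simps)

lemma prod_up_steps:
  "(\<Prod>i\<in>{i. i < length w \<and> w ! i}. qint (nat (h + bal (take i w) + 1)) q) = up_weight h w q"
proof (induction w arbitrary: h)
  case (Cons s w)
  let ?I = "{i. i < length w \<and> w ! i}"
  have "{i. i < length (s # w) \<and> (s # w) ! i} = (if s then {0} else {}) \<union> Suc ` ?I"
  proof (intro set_eqI)
    fix i
    show "i \<in> {i. i < length (s # w) \<and> (s # w) ! i} \<longleftrightarrow> i \<in> (if s then {0} else {}) \<union> Suc ` ?I"
      by (cases i) auto
  qed
  then have "(\<Prod>i\<in>{i. i < length (s # w) \<and> (s # w) ! i}.
        qint (nat (h + bal (take i (s # w)) + 1)) q) =
      (if s then qint (nat (h + 1)) q else 1) *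
        (\<Prod>i\<in>Suc ` ?I. qint (nat (h + bal (take i (s # w)) + 1)) q)"
    by simp
  also have "(\<Prod>i\<in>Suc ` ?I. qint (nat (h + bal (take i (s # w)) + 1)) q) =
      (\<Prod>i\<in>?I. qint (nat ((if s then h + 1 else h - 1) + bal (take i w) + 1)) q)"
    by (subst prod.reindex) (auto simp: algebra_simps intro!: prod.cong)
  finally show ?case by (simp add: Cons.IH)
qed simp

lemma chords_iff:
  "(i, j) \<in> chords w \<longleftrightarrow> i < j \<and> j < length w \<and> w ! i \<and> \<not> w ! j \<and>
    bal (take (Suc j) w) = bal (take i w) \<and> (\<forall>k. i < k \<and> k \<le> j \<longrightarrow> bal (take i w) < bal (take k w))"
  by (auto simp: chords_def bal_def)

text \<open>A longer chord from i would have to stay above its starting height at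
  \<open>Suc j\<close>, where the shorter one has returned to it.\<close>

lemma inj_on_fst_chords: "inj_on fst (chords w)"
proof (rule inj_onI, clarsimp)
  have "\<not> j < j'" if "(i, j) \<in> chords w" "(i, j') \<in> chords w" for i j j'
    using that unfolding chords_iff by (metis Suc_leI less_SucI less_irrefl)
  then show "j = j'" if "(i, j) \<in> chords w" "(i, j') \<in> chords w" for i j j'
    using that by (metis linorder_neqE_nat)
qed

text \<open>The path ends at height 0, so after an up step at i it comes back to the height it had
  before that step. The partner is the step into the first later position that is not above this
  height.\<close>

lemma fst_chords:
  assumes "is_dyck w"
  shows "fst ` chords w = {i. i < length w \<and> w ! i}"
proof (intro equalityI subsetI)
  fix i assume "i \<in> {i. i < length w \<and> w ! i}"
  then have i: "i < length w" "w ! i" by auto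
  define B where "B k = bal (take k w)" for k
  have step: "B (Suc k) = B k + (if w ! k then 1 else - 1)" if "k < length w" for k
    using that by (simp add: B_def take_Suc_conv_app_nth)
  have "0 \<le> B i" using is_dyck_hgt[OF assms, of "int i"] by (simp add: hgt_def B_def)
  define P where "P k \<longleftrightarrow> i < k \<and> B k \<le> B i" for k
  have ex: "P (length w)"
    using i(1) \<open>0 \<le> B i\<close> is_dyck_bal[OF assms] by (simp add: P_def B_def)
  define m where "m = (LEAST k. P k)"
  have m: "P m" "m \<le> length w"
    unfolding m_def by (rule LeastI[of P, OF ex], rule Least_le[of P, OF ex])
  have least: "\<not> P k" if "k < m" for k
    using that unfolding m_def by (rule not_less_Least)
  obtain j where j: "m = Suc j" using m(1) by (cases m) (auto simp: P_def)
  have "i \<noteq> j" using m(1) step[OF i(1)] i(2) by (auto simp: P_def j)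
  then have "i < j" using m(1) by (auto simp: P_def j)
  have above: "B i < B k" if "i < k" "k \<le> j" for k
    using least[of k] that by (auto simp: P_def j)
  have "j < length w" using m(2) j by simp
  have "\<not> w ! j \<and> B (Suc j) = B i"
    using step[OF \<open>j < length w\<close>] above[of j] \<open>i < j\<close> m(1) by (auto simp: P_def j split: if_splits)
  then have "(i, j) \<in> chords w"
    using \<open>i < j\<close> \<open>j < length w\<close> i(2) above unfolding chords_iff B_def by blast
  then show "i \<in> fst ` chords w" by force
qed (auto simp: chords_iff)

lemma prod_chords:
  assumes "is_dyck w"
  shows "(\<Prod>c\<in>chords w. qint (nat (ht w c)) q) = up_weight 0 w q"
proof -
  have "(\<Prod>c\<in>chords w. qint (nat (ht w c)) q) =
      (\<Prod>i\<in>fst ` chords w. qint (nat (0 + bal (take i w) + 1)) q)"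
    by (subst prod.reindex[OF inj_on_fst_chords]) (simp add: ht_def bal_def)
  then show ?thesis unfolding fst_chords[OF assms] prod_up_steps .
qed


section \<open>Column heights\<close>

text \<open>The up step number j + 1 counts for column i iff at most i down steps precede it, that
  is, iff it is among the first i + j + 1 steps.\<close>

lemma less_col_height_iff: "j < col_height w i \<longleftrightarrow> j < ups (take (i + j + 1) w)"
proof (induction w arbitrary: i j)
  case Nil
  then show ?case by (simp add: col_height_def)
next
  case (Cons s w)
  let ?K = "\<lambda>w i. {k. k < length w \<and> w ! k \<and> downs (take k w) \<le> i}"
  have K: "?K (s # w) i = (if s then {0} else {}) \<union>
      Suc ` {k. k < length w \<and> w ! k \<and> downs (take k w) + (if s then 0 else 1) \<le> i}"
    (is "_ = _ \<union> Suc ` ?L")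
  proof (intro set_eqI)
    fix k
    show "k \<in> ?K (s # w) i \<longleftrightarrow> k \<in> (if s then {0} else {}) \<union> Suc ` ?L"
      by (cases k) auto
  qed
  have "card (?K (s # w) i) = (if s then 1 else 0) + card ?L"
    unfolding K by (auto simp: card_image card_insert_if)
  then have col: "col_height (s # w) i =
      (if s then Suc (col_height w i) else case i of 0 \<Rightarrow> 0 | Suc i' \<Rightarrow> col_height w i')"
    by (auto simp: col_height_def split: nat.split)
  show ?case
  proof (cases s)
    case True
    then show ?thesis unfolding col using Cons.IH by (cases j) auto
  next
    case False
    \<comment> \<open>Needed for i = 0: the right side then asks for more than j up steps among j
      steps, so both sides are false.\<close>
    have "ups (take j w) \<le> j"
      using ups_plus_downs[of "take j w"] by simp
    then show ?thesis unfolding col using False Cons.IH by (cases i) auto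
  qed
qed

text \<open>Both conditions are strict because j - i and the height at i + j + 1 have opposite
  parity inside the path. Beyond its end the height is 0, while i < n forces n < j.\<close>

lemma less_col_height_hgt:
  assumes "w \<in> dyck_paths n" "i < n"
  shows "j < col_height w i \<longleftrightarrow> int j - int i < hgt w (int i + int j + 1)"
    and "col_height w i \<le> j \<longleftrightarrow> hgt w (int i + int j + 1) < int j - int i"
proof -
  have w: "length w = 2 * n" "bal w = 0" using assms by (auto simp: dyck_paths_def is_dyck_bal)
  let ?u = "take (i + j + 1) w"
  have ups: "ups w = n" using w ups_plus_downs[of w] by (simp add: bal_def)
  have nat_eq: "nat (int i + int j + 1) = i + j + 1" by auto
  have "(j < col_height w i \<longleftrightarrow> int j - int i < hgt w (int i + int j + 1)) \<and>
    (col_height w i \<le> j \<longleftrightarrow> hgt w (int i + int j + 1) < int j - int i)"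
  proof (cases "i + j + 1 \<le> 2 * n")
    case True
    then have "ups ?u + downs ?u = i + j + 1" using ups_plus_downs[of ?u] w by simp
    then show ?thesis
      unfolding not_less[symmetric] less_col_height_iff hgt_def bal_def nat_eq by linarith
  next
    case False
    then have "?u = w" using w by simp
    then show ?thesis
      unfolding not_less[symmetric] less_col_height_iff hgt_def nat_eq using False w(2) ups assms(2)
      by simp
  qed
  then show "j < col_height w i \<longleftrightarrow> int j - int i < hgt w (int i + int j + 1)"
    and "col_height w i \<le> j \<longleftrightarrow> hgt w (int i + int j + 1) < int j - int i" by auto
qed

lemma skew_cells_eq_region:
  assumes "lam \<in> dyck_paths n" "mu \<in> dyck_paths n"
  shows "skew_cells n lam mu = region lam mu"
proof (intro equalityI subsetI)
  fix z assume "z \<in> skew_cells n lam mu"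
  then show "z \<in> region lam mu"
    using less_col_height_hgt[OF assms(1)] less_col_height_hgt[OF assms(2)]
    by (auto simp: skew_cells_def region_def)
next
  fix z assume z: "z \<in> region lam mu"
  obtain x y where xy: "z = (x, y)" by (cases z)
  note bd = region_bounds[OF assms z[unfolded xy]]
  define i j where "i = nat x" and "j = nat y"
  have ij: "x = int i" "y = int j" "i < n" using bd by (auto simp: i_def j_def)
  then show "z \<in> skew_cells n lam mu"
    using less_col_height_hgt[OF assms(1) ij(3)] less_col_height_hgt[OF assms(2) ij(3)] z
    by (auto simp: skew_cells_def region_def xy)
qed

lemma weakly_above_iff:
  assumes "lam \<in> dyck_paths n" "mu \<in> dyck_paths n"
  shows "weakly_above n mu lam \<longleftrightarrow> (\<forall>p. hgt lam p \<le> hgt mu p)"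
proof
  assume le: "\<forall>p. hgt lam p \<le> hgt mu p"
  have "col_height lam i \<le> col_height mu i" if "i < n" for i
  proof (rule ccontr)
    assume "\<not> ?thesis"
    then have "col_height mu i < col_height lam i" by simp
    \<comment> \<open>The cell in row \<open>col_height mu i\<close> of this column is below lam,
      hence below mu.\<close>
    then have "col_height mu i < col_height mu i"
      using le order_less_le_trans
      unfolding less_col_height_hgt[OF assms(1) that] less_col_height_hgt[OF assms(2) that] by blast
    then show False by simp
  qed
  then show "weakly_above n mu lam" by (simp add: weakly_above_def)
next
  assume above: "weakly_above n mu lam"
  have dyck: "is_dyck lam" "is_dyck mu" "length lam = 2 * n" "length mu = 2 * n"
    using assms by (auto simp: dyck_paths_def)
  show "\<forall>p. hgt lam p \<le> hgt mu p"
  proof (rule allI, rule ccontr)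
    fix p assume "\<not> hgt lam p \<le> hgt mu p"
    then have p: "hgt mu p < hgt lam p" "0 < hgt lam p"
      using is_dyck_hgt[OF dyck(2), of p] by linarith+
    have "0 < p" using p(2) by (cases "p \<le> 0") auto
    have "p \<le> 2 * int n" using p(2) hgt_beyond[of lam p] is_dyck_bal[OF dyck(1)] dyck(3)
      by (cases "p \<le> 2 * int n") auto
    \<comment> \<open>lam passes through (x, y) at position p. The cell (x, y - 1) has its centre at
      the same position, one unit of height below lam, so it must also lie below mu.\<close>
    define x y where "x = downs (take (nat p) lam)" and "y = ups (take (nat p) lam)"
    have h: "hgt lam p = int y - int x" by (simp add: hgt_def bal_def x_def y_def)
    have sum: "int x + int y = p"
      using ups_plus_downs[of "take (nat p) lam"] \<open>0 < p\<close> \<open>p \<le> 2 * int n\<close> dyck(3)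
      by (simp add: x_def y_def)
    obtain y' where y': "y = Suc y'" using p(2) h by (cases y) auto
    have "y \<le> n"
      using hgt_le_rev[of lam p] is_dyck_bal[OF dyck(1)] dyck(3) \<open>0 < p\<close> \<open>p \<le> 2 * int n\<close> h sum by simp
    then have "x < n" using p(2) h by simp
    have arg: "int x + int y' + 1 = p" using sum y' by simp
    have "y' < col_height lam x"
      using less_col_height_hgt(1)[OF assms(1) \<open>x < n\<close>, of y', unfolded arg] h y' by simp
    then have "y' < col_height mu x" using above \<open>x < n\<close> unfolding weakly_above_def by (meson less_le_trans)
    then have "int y' - int x < hgt mu p"
      using less_col_height_hgt(1)[OF assms(2) \<open>x < n\<close>, of y', unfolded arg] by simp
    then show False using p(1) h y' by simp
  qed
qed

lemma dyck_tilings_eq: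
  assumes "lam \<in> dyck_paths n" "mu \<in> dyck_paths n"
  shows "dyck_tilings n lam mu = {TT. tiling lam mu TT}"
  by (simp add: dyck_tilings_def is_dyck_tiling_def tiling_def weakly_above_iff[OF assms]
      skew_cells_eq_region[OF assms])

section \<open>Evaluation by contracting first peaks\<close>

lemma tiling_sum_0: "tiling_sum 0 [] q = 1"
proof -
  have "tiling [] [] TT \<longleftrightarrow> TT = {}" for TT
  proof
    have empty: "region [] [] = {}" by (auto simp: region_def hgt_def)
    show "TT = {}" if "tiling [] [] TT"
    proof -
      \<comment> \<open>In an empty region every tile would be empty, but a Dyck tile has at least
        one cell.\<close>
      have "\<forall>T\<in>TT. dyck_tile T" "\<forall>T\<in>TT. T = {}"
        using that by (simp_all add: tiling_def empty)
      then show ?thesis using dyck_tile_nonempty by fastforce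
    qed
    show "tiling [] [] TT" if "TT = {}"
      using that by (simp add: tiling_def empty)
  qed
  moreover have "dyck_paths 0 = {[]}" by (auto simp: dyck_paths_def is_dyck_iff hgt_def)
  ultimately have "tilings 0 [] = {([], {})}" by (auto simp: tilings_def)
  then show ?thesis by (simp add: tiling_sum_def)
qed

lemma dyck_first_peak:
  assumes "is_dyck w" "w \<noteq> []"
  obtains h b where "w = replicate h True @ True # False # b"
proof -
  define u where "u = takeWhile id w"
  have u: "u = replicate (length u) True"
    by (rule replicate_eqI) (auto simp: u_def dest: set_takeWhileD)
  have bal_u: "bal (replicate k True) = int k" for k by (induction k) auto
  obtain v where w: "w = u @ v" and v: "v = [] \<or> (\<exists>b. v = False # b)"
  proof
    show "w = u @ dropWhile id w" by (simp add: u_def)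
    show "dropWhile id w = [] \<or> (\<exists>b. dropWhile id w = False # b)"
      by (cases "dropWhile id w") (use hd_dropWhile[of id w] in auto)
  qed
  have "v \<noteq> []" using is_dyck_bal[OF assms(1)] w assms(2) u bal_u by (metis append_Nil2 length_0_conv of_nat_eq_0_iff)
  then obtain b where b: "v = False # b" using v by blast
  have "0 \<le> bal (u @ [False])" using is_dyck_prefix[of "u @ [False]" b] assms(1) w b by simp
  then have "length u \<noteq> 0" by auto
  then obtain h where h: "length u = Suc h" by (metis not0_implies_Suc)
  show thesis
  proof
    show "w = replicate h True @ True # False # b"
      using w b u unfolding h by (simp add: replicate_app_Cons_same)
  qed
qed

text \<open>Contracting the first peak, whose up step starts at height h, splits off the same factor
  [h+1] on both sides and leaves a path of semilength one less.\<close>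

lemma tiling_sum_eq_up_weight: "mu \<in> dyck_paths n \<Longrightarrow> tiling_sum n mu q = up_weight 0 mu q"
proof (induction n arbitrary: mu)
  case 0
  then show ?case by (simp add: dyck_paths_def tiling_sum_0)
next
  case (Suc n)
  then have "is_dyck mu" "mu \<noteq> []" by (auto simp: dyck_paths_def)
  then obtain h b where mu: "mu = replicate h True @ True # False # b" by (rule dyck_first_peak)
  have "replicate h True @ b \<in> dyck_paths n" using Suc.prems unfolding mu dyck_paths_peak_iff .
  moreover have "bal (replicate h True) = int h" by (induction h) auto
  ultimately show ?case
    using Suc tiling_sum_first_peak[of h b n q] unfolding mu
    by (simp add: up_weight_peak nat_add_distrib)
qed

theorem theorem1p2:
  fixes q :: "'a::comm_ring_1" and n :: nat and mu :: "bool list"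
  assumes "mu \<in> dyck_paths n"
  shows "(\<Sum>lam\<in>dyck_paths n. \<Sum>TT\<in>dyck_tilings n lam mu. q ^ card TT)
         = (\<Prod>c\<in>chords mu. qint (nat (ht mu c)) q)"
proof -
  have fin: "finite {TT. tiling lam mu TT}" if "lam \<in> dyck_paths n" for lam
    using that assms by (rule finite_tilings_between)
  have "(\<Sum>lam\<in>dyck_paths n. \<Sum>TT\<in>dyck_tilings n lam mu. q ^ card TT) =
      (\<Sum>lam\<in>dyck_paths n. \<Sum>TT\<in>{TT. tiling lam mu TT}. q ^ card TT)"
    by (rule sum.cong) (simp_all add: dyck_tilings_eq assms)
  also have "\<dots> = tiling_sum n mu q"
    unfolding tiling_sum_def tilings_def
    by (rule sum.Sigma) (use finite_dyck_paths fin in auto)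
  also have "\<dots> = up_weight 0 mu q" using assms by (rule tiling_sum_eq_up_weight)
  also have "\<dots> = (\<Prod>c\<in>chords mu. qint (nat (ht mu c)) q)"
    using assms by (simp add: prod_chords dyck_paths_def)
  finally show ?thesis .
qed

end
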